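(* Let $f:\mathbb N\to\mathbb C$ be a function, and for real $x\ge 1$ and $t\in\mathbb R$ let $S(x,t)=\sum_{1\le n\le x} f(n)e^{2\pi i nt}$ and $F(t)=\sum_{n=1}^\infty \frac{f(n)e^{2\pi i nt}}{n}$. Assume that for some constants $C>0$ and $0<\alpha<1$ we have $|S(x,t)|\le Cx^{\alpha}$ for all real $x\ge 1$ and all $t\in\mathbb R$. Then: (i) The upper box-counting dimension of the image $F([0,1])=\{(\operatorname{Re}F(t),\operatorname{Im}F(t))\in\mathbb R^2: t\in[0,1]\}$ satisfies $$\overline{\dim_B}(F([0,1]))\le\frac{1}{1-\alpha}.$$ (ii) The upper box-counting dimension of the graph $G(F)=\{(t,|F(t)|)\in\mathbb R^2: t\in[0,1]\}$ satisfies $$\overline{\dim_B}(G(F))\le 1+\alpha.$$ Moreover, the same bound holds for the upper box-counting dimensions of the graphs $G_R(F)=\{(t,\operatorname{Re}F(t)): t\in[0,1]\}$ and $G_I(F)=\{(t,\operatorname{Im}F(t)): t\in[0,1]\}$.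
   Context: $\mathbb N=\{1,2,3,\dots\}$. The infinite series defining $F(t)$ is understood as the limit of its partial sums $\sum_{n=1}^N$ as $N\to\infty$; under the hypothesis of the claim this limit exists for every $t\in\mathbb R$. For a bounded set $E\subset\mathbb R^d$ and $r>0$, let $N(E,r)$ be the minimal number of sets of diameter at most $r$ needed to cover $E$. The upper box-counting dimension of $E$ is $\overline{\dim_B}E=\limsup_{r\to0}\frac{\log N(E,r)}{\log(1/r)}$. *)

theory Defs
  imports "HOL-Analysis.Analysis"
begin

text \<open>The conjunct \<open>bounded U\<close> is needed because \<^const>\<open>diameter\<close> is real-valued and carries no
  information for unbounded sets.\<close>

definition covering_number :: "'a::euclidean_space set \<Rightarrow> real \<Rightarrow> nat" where
  "covering_number E r =
     (LEAST k. \<exists>\<U>. finite \<U> \<and> card \<U> = k \<and> E \<subseteq> \<Union>\<U> \<and>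
        (\<forall>U\<in>\<U>. bounded U \<and> diameter U \<le> r))"

text \<open>An unbounded set has no finite cover by sets of bounded diameter, so its dimension is set to
  \<open>\<infinity>\<close>; an upper bound on \<open>upper_box_dim E\<close> by a real number thus includes that \<open>E\<close> is bounded.
  The empty set gets dimension \<open>0\<close>, as \<open>ln 0 = 0\<close>.\<close>

definition upper_box_dim :: "'a::euclidean_space set \<Rightarrow> ereal" where
  "upper_box_dim E =
     (if bounded E
      then Limsup (at_right 0) (\<lambda>r. ereal (ln (real (covering_number E r)) / ln (1 / r)))
      else \<infinity>)"

text \<open>A function on the positive integers is a function on \<^typ>\<open>nat\<close> whose value at \<open>0\<close> is never
  used.\<close>

definition exp_sum :: "(nat \<Rightarrow> complex) \<Rightarrow> real \<Rightarrow> real \<Rightarrow> complex" where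
  "exp_sum f x t =
     (\<Sum>n\<in>{n. 1 \<le> n \<and> real n \<le> x}. f n * exp (2 * of_real pi * \<i> * of_nat n * of_real t))"

text \<open>The series need not converge absolutely, so it is a limit of partial sums in the natural
  order.\<close>

definition exp_series :: "(nat \<Rightarrow> complex) \<Rightarrow> real \<Rightarrow> complex" where
  "exp_series f t =
     lim (\<lambda>N. \<Sum>n=1..N. f n * exp (2 * of_real pi * \<i> * of_nat n * of_real t) / of_nat n)"

end

theory Submission
  imports Defs
begin

text \<open>Summation by parts shows that the \<open>N\<close>-th partial sum of \<open>F\<close> differs from \<open>F\<close> by \<open>O(N powr (\<alpha> - 1))\<close>,
  uniformly in \<open>t\<close>. The derivative of this partial sum is \<open>2\<pi>\<i> S(N,t)\<close>, so it is Lipschitz with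
  constant \<open>O(N powr \<alpha>)\<close>. Taking \<open>N\<close> of size \<open>1/\<bar>t - s\<bar>\<close> shows that \<open>F\<close> is Hoelder continuous
  with exponent \<open>1 - \<alpha>\<close>; both dimension bounds hold for all such functions.\<close>

section \<open>Box dimension bounds from covers\<close>

text \<open>Dividing the logarithm of the count by \<open>ln (1 / r)\<close> leaves
  \<open>s + ln K / ln (1 / r)\<close>, and the second term vanishes as \<open>r\<close> tends to 0.
  A cover at a single scale already makes \<open>E\<close> bounded, which excludes the value
  infinity.\<close>

lemma upper_box_dim_leI:
  fixes E :: "'a::euclidean_space set"
  assumes K: "K \<ge> 1" and s: "s \<ge> 0"
    and cover: "\<And>r. 0 < r \<Longrightarrow> r < 1 \<Longrightarrow> \<exists>\<U>. finite \<U> \<and> real (card \<U>) \<le> K * (1 / r) powr s \<and>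
        E \<subseteq> \<Union>\<U> \<and> (\<forall>U\<in>\<U>. bounded U \<and> diameter U \<le> r)"
  shows "upper_box_dim E \<le> ereal s"
proof -
  have "bounded E"
  proof -
    obtain \<U> where "finite \<U>" "E \<subseteq> \<Union>\<U>" "\<forall>U\<in>\<U>. bounded U"
      using cover[of "1/2"] by auto
    then show ?thesis by (meson bounded_Union bounded_subset)
  qed
  have le: "ln (real (covering_number E r)) / ln (1 / r) \<le> ln K / ln (1 / r) + s"
    if r: "0 < r" "r < 1" for r
  proof -
    obtain \<U> where U: "finite \<U>" "real (card \<U>) \<le> K * (1 / r) powr s" "E \<subseteq> \<Union>\<U>"
        "\<forall>U\<in>\<U>. bounded U \<and> diameter U \<le> r"
      using cover[OF r] by auto
    have "covering_number E r \<le> card \<U>"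
      unfolding covering_number_def by (rule Least_le) (use U in blast)
    then have N: "real (covering_number E r) \<le> K * (1 / r) powr s" using U(2) by linarith
    have pos: "ln (1 / r) > 0" using r by simp
    have "ln (real (covering_number E r)) \<le> ln K + s * ln (1 / r)"
    proof (cases "covering_number E r = 0")
      \<comment> \<open>Here \<open>ln 0 = 0\<close>, so the right-hand side only has to be
        nonnegative; this follows from \<open>K \<ge> 1\<close>, \<open>s \<ge> 0\<close> and
        \<open>r < 1\<close>.\<close>
      case True
      then show ?thesis using K s pos by (simp add: add_nonneg_nonneg)
    next
      case False
      then have "ln (real (covering_number E r)) \<le> ln (K * (1 / r) powr s)"
        using N by (intro ln_mono) auto
      also have "\<dots> = ln K + s * ln (1 / r)"
        using K r by (simp add: ln_mult ln_powr)
      finally show ?thesis .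
    qed
    then show ?thesis using pos by (simp add: field_simps)
  qed
  have ev: "\<forall>\<^sub>F r in at_right (0::real). 0 < r \<and> r < 1"
    using eventually_at_right_real[of 0 "1::real"] by (auto elim: eventually_mono)
  have "((\<lambda>r::real. ln K / ln (1 / r) + s) \<longlongrightarrow> 0 + s) (at_right 0)"
  proof (intro tendsto_intros)
    have "filterlim (\<lambda>r::real. ln (1 / r)) at_top (at_right 0)"
      by (rule filterlim_compose[OF ln_at_top])
         (use filterlim_inverse_at_top_right in \<open>simp add: inverse_eq_divide\<close>)
    then show "((\<lambda>r::real. ln K / ln (1 / r)) \<longlongrightarrow> 0) (at_right 0)"
      by (intro real_tendsto_divide_at_top[OF tendsto_const])
  qed
  then have "((\<lambda>r::real. ereal (ln K / ln (1 / r) + s)) \<longlongrightarrow> ereal s) (at_right 0)"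
    by simp
  then have "Limsup (at_right 0) (\<lambda>r::real. ereal (ln K / ln (1 / r) + s)) = ereal s"
    by (intro lim_imp_Limsup) auto
  moreover have "Limsup (at_right 0) (\<lambda>r. ereal (ln (real (covering_number E r)) / ln (1 / r)))
      \<le> Limsup (at_right 0) (\<lambda>r::real. ereal (ln K / ln (1 / r) + s))"
    by (intro Limsup_mono eventually_mono[OF ev]) (use le in auto)
  ultimately show ?thesis
    unfolding upper_box_dim_def using \<open>bounded E\<close> by simp
qed

section \<open>Hoelder functions on the unit interval\<close>

lemma unit_interval_cell:
  fixes t :: real and m :: nat
  assumes t: "t \<in> {0..1}" and m: "m > 0"
  obtains i where "i \<le> m" "real i / m \<le> t" "t \<le> real (i + 1) / m"
proof
  \<comment> \<open>At \<open>t = 1\<close> the floor equals \<open>m\<close>, and that cell starts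
    at 1. This is why the covers below use the \<open>m + 1\<close> indices in
    \<open>{..m}\<close>.\<close>
  define i where "i = nat \<lfloor>t * m\<rfloor>"
  have i: "real i \<le> t * m" "t * m < real i + 1"
    using t by (auto simp: i_def)
  have "t * m \<le> 1 * real m" using t by (intro mult_right_mono) auto
  then show "i \<le> m" using i by linarith
  show "real i / m \<le> t" "t \<le> real (i + 1) / m"
    using i m by (auto simp: field_simps)
qed

text \<open>A cell of length \<open>1 / m\<close> has an image of diameter at most
  \<open>L * (1 / m) powr \<beta>\<close>. This drops to \<open>r\<close> once \<open>m\<close> is
  of order \<open>r powr (- 1 / \<beta>)\<close>, which is then also the order of the number of
  images needed.\<close>

lemma upper_box_dim_Holder_image:
  fixes g :: "real \<Rightarrow> 'a::euclidean_space"
  assumes L: "L > 0" and b: "\<beta> > 0"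
    and hol: "\<And>s t. s \<in> {0..1} \<Longrightarrow> t \<in> {0..1} \<Longrightarrow> norm (g s - g t) \<le> L * \<bar>s - t\<bar> powr \<beta>"
  shows "upper_box_dim (g ` {0..1}) \<le> ereal (1 / \<beta>)"
proof (rule upper_box_dim_leI)
  show "L powr (1 / \<beta>) + 2 \<ge> 1" by (simp add: add_nonneg_nonneg)
  show "0 \<le> 1 / \<beta>" using b by simp
  fix r :: real assume r: "0 < r" "r < 1"
  \<comment> \<open>The solution of \<open>L * (1 / x) powr \<beta> = r\<close>.\<close>
  define x where "x = (L / r) powr (1 / \<beta>)"
  define m where "m = nat \<lceil>x\<rceil>"
  have x0: "x > 0" using L r by (simp add: x_def)
  then have m: "m > 0" "x \<le> m" "m \<le> x + 1" by (simp_all add: m_def)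
  \<comment> \<open>The intersection trims the cell with \<open>i = m\<close>, which sticks out of
    the interval where the Hoelder bound is available.\<close>
  define V where "V i = g ` ({0..1} \<inter> {real i / m..real (i + 1) / m})" for i
  have close: "norm (p - q) \<le> r" if pq: "p \<in> V i" "q \<in> V i" for p q i
  proof -
    obtain s t where st: "p = g s" "q = g t" "s \<in> {0..1}" "t \<in> {0..1}"
      "s \<in> {real i / m..real (i + 1) / m}" "t \<in> {real i / m..real (i + 1) / m}"
      using pq unfolding V_def by blast
    have "\<bar>s - t\<bar> \<le> 1 / m" using st(5,6) m(1) by (auto simp: add_divide_distrib)
    also have "\<dots> \<le> 1 / x" using m x0 by (simp add: frac_le)
    finally have "\<bar>s - t\<bar> powr \<beta> \<le> (1 / x) powr \<beta>" using b by (intro powr_mono2) auto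
    also have "\<dots> = r / L"
      using L r b by (simp add: x_def powr_divide powr_powr)
    finally have "L * \<bar>s - t\<bar> powr \<beta> \<le> r" using L by (simp add: field_simps)
    then show ?thesis using hol[OF st(3,4)] st(1,2) by simp
  qed
  show "\<exists>\<U>. finite \<U> \<and> real (card \<U>) \<le> (L powr (1 / \<beta>) + 2) * (1 / r) powr (1 / \<beta>) \<and>
      g ` {0..1} \<subseteq> \<Union>\<U> \<and> (\<forall>U\<in>\<U>. bounded U \<and> diameter U \<le> r)"
  proof (intro exI conjI ballI)
    show "finite (V ` {..m})" by simp
    have "real (card (V ` {..m})) \<le> m + 1" using card_image_le[of "{..m}" V] by simp
    \<comment> \<open>One unit comes from rounding \<open>x\<close> up, the other from the
      additional cell; both are absorbed because
      \<open>(1 / r) powr (1 / \<beta>) \<ge> 1\<close>.\<close>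
    also have "\<dots> \<le> x + 2 * 1" using m by simp
    also have "\<dots> \<le> x + 2 * (1 / r) powr (1 / \<beta>)"
      using r b by (intro add_left_mono mult_left_mono ge_one_powr_ge_zero) auto
    also have "\<dots> = (L powr (1 / \<beta>) + 2) * (1 / r) powr (1 / \<beta>)"
      using L r by (simp add: x_def powr_divide field_simps)
    finally show "real (card (V ` {..m})) \<le> (L powr (1 / \<beta>) + 2) * (1 / r) powr (1 / \<beta>)" .
    show "g ` {0..1} \<subseteq> \<Union>(V ` {..m})"
    proof
      fix p assume "p \<in> g ` {0..1}"
      then obtain t where t: "p = g t" "t \<in> {0..1}" by auto
      obtain i where "i \<le> m" "real i / m \<le> t" "t \<le> real (i + 1) / m"
        using unit_interval_cell[OF t(2) m(1)] by blast
      then show "p \<in> \<Union>(V ` {..m})" using t unfolding V_def by (intro UN_I[of i]) auto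
    qed
    fix U assume "U \<in> V ` {..m}"
    then obtain i where U: "U = V i" by auto
    show "diameter U \<le> r" unfolding U using close r by (intro diameter_le) auto
    show "bounded U" unfolding U bounded_two_points dist_norm using close by blast
  qed
qed

text \<open>About \<open>1 / r\<close> columns of width at most \<open>r / 2\<close> cover the
  graph. Over each of them \<open>g\<close> oscillates by \<open>O(r powr \<beta>)\<close>, so
  \<open>O(r powr (\<beta> - 1))\<close> boxes of height \<open>r / 2\<close> suffice, which makes
  \<open>O(r powr (\<beta> - 2))\<close> boxes in total.\<close>

lemma upper_box_dim_Holder_graph:
  fixes g :: "real \<Rightarrow> real"
  assumes L: "L > 0" and b: "\<beta> > 0" "\<beta> \<le> 1"
    and hol: "\<And>s t. s \<in> {0..1} \<Longrightarrow> t \<in> {0..1} \<Longrightarrow> \<bar>g s - g t\<bar> \<le> L * \<bar>s - t\<bar> powr \<beta>"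
  shows "upper_box_dim ((\<lambda>t. (t, g t)) ` {0..1}) \<le> ereal (2 - \<beta>)"
proof (rule upper_box_dim_leI)
  show "4 * (4 * L + 1) \<ge> 1" using L by simp
  show "0 \<le> 2 - \<beta>" using b by simp
  fix r :: real assume r: "0 < r" "r < 1"
  \<comment> \<open>Columns of width at most \<open>r / 2\<close> and boxes of height
    \<open>r / 2\<close> give diameter at most \<open>r\<close> when the two side lengths are
    added.\<close>
  define m where "m = nat \<lceil>2 / r\<rceil>"
  have r2: "2 / r > 0" using r by simp
  then have m: "m > 0" "2 / r \<le> m" "m \<le> 2 / r + 1" unfolding m_def by linarith+
  \<comment> \<open>Over column \<open>i\<close> the values of \<open>g\<close> differ from the
    value at the left endpoint by at most \<open>h\<close>, so they lie between \<open>a i\<close>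
    and \<open>a i + 2 * h\<close>. Boxes of height \<open>r / 2\<close> stacked up from
    \<open>a i\<close> then have indices at most \<open>2 * h / (r / 2) = 4 * h / r\<close>, whence
    \<open>k\<close>.\<close>
  define h where "h = L * (1 / m) powr \<beta>"
  have h0: "h \<ge> 0" using L by (simp add: h_def)
  define a where "a i = g (real i / m) - h" for i :: nat
  define k where "k = nat \<lfloor>4 * h / r\<rfloor>"
  define V where "V = (\<lambda>(i::nat, j::nat). {real i / m..real (i + 1) / m} \<times>
     {a i + j * (r / 2)..a i + real (j + 1) * (r / 2)})"
  have m2: "1 / m \<le> r / 2" using m r by (simp add: field_simps)
  have close: "norm (p - q) \<le> r" if pq: "p \<in> V ij" "q \<in> V ij" for p q ij
  proof -
    obtain i j where ij: "ij = (i, j)" by force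
    have "\<bar>fst p - fst q\<bar> \<le> 1 / m"
      using pq m(1) by (auto simp: V_def ij add_divide_distrib)
    moreover have "\<bar>snd p - snd q\<bar> \<le> r / 2"
    proof -
      have "snd p \<in> {a i + j * (r / 2)..a i + real (j + 1) * (r / 2)}"
        "snd q \<in> {a i + j * (r / 2)..a i + real (j + 1) * (r / 2)}"
        using pq by (auto simp: V_def ij)
      moreover have "real (j + 1) * (r / 2) = j * (r / 2) + r / 2" by (simp add: algebra_simps)
      ultimately show ?thesis unfolding atLeastAtMost_iff abs_le_iff by linarith
    qed
    moreover have "norm (p - q) \<le> \<bar>fst p - fst q\<bar> + \<bar>snd p - snd q\<bar>"
      using norm_Pair_le[of "fst p - fst q" "snd p - snd q"]
      by (metis diff_Pair prod.collapse real_norm_def)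
    ultimately show ?thesis using m2 by linarith
  qed
  show "\<exists>\<U>. finite \<U> \<and> real (card \<U>) \<le> 4 * (4 * L + 1) * (1 / r) powr (2 - \<beta>) \<and>
      (\<lambda>t. (t, g t)) ` {0..1} \<subseteq> \<Union>\<U> \<and> (\<forall>U\<in>\<U>. bounded U \<and> diameter U \<le> r)"
  proof (intro exI conjI ballI)
    let ?I = "{..m} \<times> {..k}"
    show "finite (V ` ?I)" by simp
    have "real (card (V ` ?I)) \<le> (real m + 1) * (real k + 1)"
      using card_image_le[of ?I V] by (simp flip: of_nat_Suc of_nat_mult add: add.commute)
    \<comment> \<open>The first factor bounds the columns, \<open>m + 1 \<le> 2 / r + 2\<close>, and
      the second the boxes per column. The \<open>+ 1\<close> in the latter is absorbed since
      \<open>\<beta> \<le> 1\<close> makes the power at least 1.\<close>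
    also have "\<dots> \<le> (4 * (1 / r)) * ((4 * L + 1) * (1 / r) powr (1 - \<beta>))"
    proof (rule mult_mono)
      have "1 \<le> 1 / r" using r by simp
      then show "real m + 1 \<le> 4 * (1 / r)" using m by simp
      have "h \<le> L * r powr \<beta>"
        unfolding h_def using m2 r b L by (intro mult_left_mono powr_mono2) auto
      then have "4 * h / r \<le> 4 * (L * r powr \<beta>) / r"
        using r by (intro divide_right_mono) auto
      also have "\<dots> = 4 * L * (1 / r) powr (1 - \<beta>)"
        using r by (simp add: powr_diff powr_divide)
      finally have "4 * h / r \<le> 4 * L * (1 / r) powr (1 - \<beta>)" .
      moreover have "real k \<le> 4 * h / r" using h0 r by (simp add: k_def)
      moreover have "1 \<le> (1 / r) powr (1 - \<beta>)"
        using r b by (intro ge_one_powr_ge_zero) auto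
      ultimately show "real k + 1 \<le> (4 * L + 1) * (1 / r) powr (1 - \<beta>)"
        by (simp add: distrib_right)
    qed (use r in auto)
    also have "\<dots> = 4 * (4 * L + 1) * (1 / r) powr (2 - \<beta>)"
      using r powr_add[of "1 / r" 1 "1 - \<beta>"] by (simp add: algebra_simps)
    finally show "real (card (V ` ?I)) \<le> 4 * (4 * L + 1) * (1 / r) powr (2 - \<beta>)" .
    show "(\<lambda>t. (t, g t)) ` {0..1} \<subseteq> \<Union>(V ` ?I)"
    proof
      fix p assume "p \<in> (\<lambda>t. (t, g t)) ` {0..1}"
      then obtain t where t: "p = (t, g t)" "t \<in> {0..1}" by auto
      obtain i where i: "i \<le> m" "real i / m \<le> t" "t \<le> real (i + 1) / m"
        using unit_interval_cell[OF t(2) m(1)] by blast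
      have "\<bar>t - i / m\<bar> \<le> 1 / m" using i m(1) by (auto simp: add_divide_distrib)
      then have "L * \<bar>t - i / m\<bar> powr \<beta> \<le> h"
        unfolding h_def using L b by (intro mult_left_mono powr_mono2) auto
      moreover have "\<bar>g t - g (i / m)\<bar> \<le> L * \<bar>t - i / m\<bar> powr \<beta>"
        using t i m(1) by (intro hol) auto
      ultimately have g: "0 \<le> g t - a i" "g t - a i \<le> 2 * h" by (auto simp: a_def)
      define j where "j = nat \<lfloor>(g t - a i) / (r / 2)\<rfloor>"
      have q: "(g t - a i) / (r / 2) \<ge> 0" using g r by simp
      have "(g t - a i) / (r / 2) \<le> 2 * h / (r / 2)" using g r by (intro divide_right_mono) auto
      then have "(g t - a i) / (r / 2) \<le> 4 * h / r" by simp
      then have "j \<le> k" unfolding j_def k_def by (intro nat_mono floor_mono)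
      have "real j \<le> (g t - a i) / (r / 2)" "(g t - a i) / (r / 2) \<le> real (j + 1)"
        using q unfolding j_def by linarith+
      then have "j * (r / 2) \<le> g t - a i" "g t - a i \<le> real (j + 1) * (r / 2)"
        using r by (simp_all add: field_simps)
      then have "p \<in> V (i, j)" using i t by (auto simp: V_def)
      then show "p \<in> \<Union>(V ` ?I)" using i(1) \<open>j \<le> k\<close> by blast
    qed
    fix U assume "U \<in> V ` ?I"
    then obtain ij where U: "U = V ij" by auto
    show "diameter U \<le> r" unfolding U using close r by (intro diameter_le) auto
    show "bounded U" unfolding U bounded_two_points dist_norm using close by blast
  qed
qed

section \<open>Convergence with a rate\<close>

text \<open>Summing the increments telescopes to \<open>norm (A m - A n) \<le> g n - g m\<close>.
  This gives the Cauchy property, and letting \<open>m\<close> tend to infinity gives the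
  rate.\<close>

lemma telescoping_majorant_tendsto:
  fixes A :: "nat \<Rightarrow> 'a::banach" and g :: "nat \<Rightarrow> real"
  assumes g: "g \<longlonglongrightarrow> 0"
    and step: "\<And>n. n \<ge> k \<Longrightarrow> norm (A (Suc n) - A n) \<le> g n - g (Suc n)"
  obtains l where "A \<longlonglongrightarrow> l" "\<And>n. n \<ge> k \<Longrightarrow> norm (l - A n) \<le> g n"
proof -
  have diff: "norm (A m - A n) \<le> g n - g m" if "k \<le> n" "n \<le> m" for n m
    using that(2)
  proof (induction m rule: dec_induct)
    case base
    then show ?case by simp
  next
    case (step m)
    have "norm (A (Suc m) - A n) \<le> norm (A (Suc m) - A m) + norm (A m - A n)"
      using norm_triangle_ineq[of "A (Suc m) - A m" "A m - A n"] by simp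
    then show ?case using step.IH assms(2)[of m] step.hyps that(1) by linarith
  qed
  have "Cauchy A"
  proof (rule CauchyI')
    fix e :: real assume "e > 0"
    then have "e / 2 > 0" by simp
    then obtain M where M: "\<And>n. n \<ge> M \<Longrightarrow> \<bar>g n\<bar> < e / 2"
      using LIMSEQ_D[OF g] by fastforce
    show "\<exists>M. \<forall>m\<ge>M. \<forall>n>m. dist (A m) (A n) < e"
    proof (intro exI allI impI)
      fix m n assume mn: "m \<ge> max M k" "n > m"
      then have "norm (A n - A m) \<le> g m - g n" by (intro diff) auto
      then show "dist (A m) (A n) < e"
        using M[of m] M[of n] mn by (simp add: dist_norm norm_minus_commute)
    qed
  qed
  then obtain l where l: "A \<longlonglongrightarrow> l" using Cauchy_convergent convergent_def by blast
  have "norm (l - A n) \<le> g n" if n: "n \<ge> k" for n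
  proof (rule tendsto_le[OF sequentially_bot])
    show "(\<lambda>m. norm (A m - A n)) \<longlonglongrightarrow> norm (l - A n)" using l by (intro tendsto_intros)
    show "(\<lambda>m. g n - g m) \<longlonglongrightarrow> g n" using tendsto_diff[OF tendsto_const g] by simp
    show "\<forall>\<^sub>F m in sequentially. norm (A m - A n) \<le> g n - g m"
      using eventually_ge_at_top[of n] by eventually_elim (use diff n in auto)
  qed
  then show ?thesis using l that by blast
qed

text \<open>A discrete form of comparing a sum with an integral: it turns the increments
  \<open>(n + 1) powr (\<alpha> - 2)\<close> into a telescoping difference, with
  \<open>b = 1 - \<alpha>\<close>. The proof combines \<open>ln y \<le> y - 1\<close> at
  \<open>y = x / (x + 1)\<close> with \<open>1 + u \<le> exp u\<close>.\<close>

lemma powr_neg_diff_ge: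
  fixes x b :: real
  assumes "x > 0" "b \<ge> 0"
  shows "b * (x + 1) powr (- b - 1) \<le> x powr (- b) - (x + 1) powr (- b)"
proof -
  have x1: "x + 1 > 0" using assms by simp
  have "ln (x / (x + 1)) \<le> x / (x + 1) - 1" using assms by (intro ln_le_minus_one) simp
  also have "\<dots> = - (1 / (x + 1))" using x1 by (simp add: field_simps)
  finally have "b * (1 / (x + 1)) \<le> b * - ln (x / (x + 1))"
    using assms by (intro mult_left_mono) auto
  then have "1 + b / (x + 1) \<le> 1 + - b * ln (x / (x + 1))" by simp
  also have "\<dots> \<le> exp (- b * ln (x / (x + 1)))" by (rule exp_ge_add_one_self)
  also have "\<dots> = (x / (x + 1)) powr (- b)" using assms by (simp add: powr_def)
  also have "\<dots> = x powr (- b) / (x + 1) powr (- b)" using assms by (simp add: powr_divide)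
  finally have "(1 + b / (x + 1)) * (x + 1) powr (- b) \<le> x powr (- b)"
    using x1 by (simp add: field_simps)
  moreover have "(x + 1) powr (- b - 1) = (x + 1) powr (- b) / (x + 1)"
    using x1 by (simp add: powr_diff)
  ultimately show ?thesis by (simp add: algebra_simps)
qed

section \<open>Partial sums and their derivatives\<close>

definition exp_series_partial :: "(nat \<Rightarrow> complex) \<Rightarrow> nat \<Rightarrow> real \<Rightarrow> complex" where
  "exp_series_partial f N t =
     (\<Sum>n=1..N. f n * exp (2 * of_real pi * \<i> * of_nat n * of_real t) / of_nat n)"

lemma exp_sum_of_nat:
  "exp_sum f (real N) t = (\<Sum>n=1..N. f n * exp (2 * of_real pi * \<i> * of_nat n * of_real t))"
  unfolding exp_sum_def by (rule sum.cong) auto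

text \<open>Differentiation brings down a factor \<open>n\<close> from each exponential, which
  cancels the denominator and leaves the sum whose size is controlled by hypothesis.\<close>

lemma has_vector_derivative_exp_series_partial:
  "(exp_series_partial f N has_vector_derivative 2 * of_real pi * \<i> * exp_sum f (real N) t)
     (at t within S)"
proof -
  have "((\<lambda>t. f n * exp (2 * of_real pi * \<i> * of_nat n * of_real t) / of_nat n)
      has_vector_derivative
      2 * of_real pi * \<i> * (f n * exp (2 * of_real pi * \<i> * of_nat n * of_real t)))
      (at t within S)" if "n \<in> {1..N}" for n
  proof -
    have "((\<lambda>z. f n * exp (2 * of_real pi * \<i> * of_nat n * z) / of_nat n)
      has_field_derivative
      2 * of_real pi * \<i> * (f n * exp (2 * of_real pi * \<i> * of_nat n * of_real t)))
      (at (of_real t))"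
      using that by (auto intro!: derivative_eq_intros)
    then show ?thesis by (rule has_vector_derivative_real_field)
  qed
  then have "((\<lambda>t. \<Sum>n=1..N. f n * exp (2 * of_real pi * \<i> * of_nat n * of_real t) / of_nat n)
      has_vector_derivative
      (\<Sum>n=1..N. 2 * of_real pi * \<i> * (f n * exp (2 * of_real pi * \<i> * of_nat n * of_real t))))
      (at t within S)"
    by (rule has_vector_derivative_sum)
  then show ?thesis
    unfolding exp_sum_of_nat sum_distrib_left[symmetric] exp_series_partial_def[abs_def] .
qed

section \<open>Hoelder continuity of the series\<close>

context
  fixes f :: "nat \<Rightarrow> complex" and C \<alpha> :: real
  assumes C: "C > 0" and a: "0 < \<alpha>" "\<alpha> < 1"
    and S_le: "\<And>x t :: real. x \<ge> 1 \<Longrightarrow> norm (exp_sum f x t) \<le> C * x powr \<alpha>"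
begin

lemma exp_series_partial_Lipschitz:
  assumes "N \<ge> 1"
  shows "norm (exp_series_partial f N t - exp_series_partial f N s)
    \<le> 2 * pi * C * real N powr \<alpha> * \<bar>t - s\<bar>"
proof -
  have "norm (exp_series_partial f N t - exp_series_partial f N s)
      \<le> 2 * pi * C * real N powr \<alpha> * norm (t - s)"
  proof (rule differentiable_bound[of UNIV])
    fix x :: real
    show "(exp_series_partial f N has_derivative
        (\<lambda>h. h *\<^sub>R (2 * of_real pi * \<i> * exp_sum f (real N) x))) (at x within UNIV)"
      using has_vector_derivative_exp_series_partial unfolding has_vector_derivative_def .
    have "norm (2 * of_real pi * \<i> * exp_sum f (real N) x) \<le> 2 * pi * C * real N powr \<alpha>"
      using S_le[of "real N" x] assms by (simp add: norm_mult)
    then show "onorm (\<lambda>h. h *\<^sub>R (2 * of_real pi * \<i> * exp_sum f (real N) x))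
        \<le> 2 * pi * C * real N powr \<alpha>"
      by (intro onorm_le) (simp add: mult.commute mult_left_mono)
  qed auto
  then show ?thesis by simp
qed

text \<open>The quotient is the boundary term of the summation by parts below.\<close>

lemma norm_exp_sum_div_le:
  assumes "N \<ge> 1"
  shows "norm (exp_sum f (real N) t / of_nat (Suc N)) \<le> C * real N powr (\<alpha> - 1)"
proof -
  have "norm (exp_sum f (real N) t / of_nat (Suc N)) \<le> (C * real N powr \<alpha>) / real N"
    unfolding norm_divide norm_of_nat using S_le[of "real N" t] assms C by (intro frac_le) auto
  then show ?thesis using assms by (simp add: powr_diff)
qed

text \<open>Summation by parts writes the partial sum as the boundary term \<open>R N\<close> plus
  the sum of \<open>S(n,t) / (n (n + 1))\<close> over \<open>n\<close> up to \<open>N\<close>. The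
  tail of the latter sum contributes \<open>C / (1 - \<alpha>)\<close> to the constant, the boundary
  term contributes \<open>C\<close>.\<close>

lemma exp_series_tail_le:
  assumes "N \<ge> 1"
  shows "norm (exp_series f t - exp_series_partial f N t)
    \<le> (C / (1 - \<alpha>) + C) * real N powr (\<alpha> - 1)"
proof -
  define R where "R N = exp_sum f (real N) t / of_nat (Suc N)" for N
  define A where "A N = exp_series_partial f N t - R N" for N
  \<comment> \<open>The factor \<open>1 / (1 - \<alpha>)\<close> cancels the \<open>b\<close> of
    \<open>powr_neg_diff_ge\<close>, so that one decrement of \<open>g\<close> dominates
    \<open>C * (n + 1) powr (\<alpha> - 2)\<close>.\<close>
  define g where "g N = C / (1 - \<alpha>) * real N powr (\<alpha> - 1)" for N
  have p0: "(\<lambda>N. real N powr (\<alpha> - 1)) \<longlonglongrightarrow> 0"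
    using a by (intro tendsto_neg_powr filterlim_real_sequentially) auto
  then have g0: "g \<longlonglongrightarrow> 0"
    unfolding g_def by (rule tendsto_mult_right_zero)
  have R_le: "norm (R n) \<le> C * real n powr (\<alpha> - 1)" if "n \<ge> 1" for n
    unfolding R_def by (rule norm_exp_sum_div_le[OF that])
  have R0: "R \<longlonglongrightarrow> 0"
    by (rule Lim_null_comparison[OF _ tendsto_mult_right_zero[OF p0, of C]])
       (use R_le in \<open>intro eventually_sequentiallyI[of 1], simp\<close>)
  have step: "norm (A (Suc n) - A n) \<le> g n - g (Suc n)" if n: "n \<ge> 1" for n
  proof -
    define T where "T = exp_sum f (real n) t"
    define e where "e = f (Suc n) * exp (2 * of_real pi * \<i> * of_nat (Suc n) * of_real t)"
    have S: "exp_sum f (real (Suc n)) t = T + e"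
      unfolding T_def e_def exp_sum_of_nat by simp
    have P: "exp_series_partial f (Suc n) t = exp_series_partial f n t + e / of_nat (Suc n)"
      unfolding exp_series_partial_def e_def by simp
    have nz: "of_nat (Suc n) \<noteq> (0::complex)" "of_nat (Suc (Suc n)) \<noteq> (0::complex)"
      by (simp_all only: of_nat_eq_0_iff)
    have "A (Suc n) - A n = e / of_nat (Suc n) - (T + e) / of_nat (Suc (Suc n)) + T / of_nat (Suc n)"
      unfolding A_def R_def S P T_def[symmetric] by simp
    also have "\<dots> = (T + e) * (1 / of_nat (Suc n) - 1 / of_nat (Suc (Suc n)))"
      by (simp add: algebra_simps add_divide_distrib)
    also have "1 / of_nat (Suc n) - 1 / of_nat (Suc (Suc n))
        = (1 / of_nat (Suc n) / of_nat (Suc (Suc n)) :: complex)"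
      using nz by (simp add: divide_simps del: of_nat_Suc) simp
    finally have "A (Suc n) - A n = R (Suc n) / of_nat (Suc n)"
      by (simp only: R_def S) simp
    then have "norm (A (Suc n) - A n) = norm (R (Suc n)) / real (Suc n)"
      by (simp only: norm_divide norm_of_nat)
    also have "\<dots> \<le> C * real (Suc n) powr (\<alpha> - 1) / real (Suc n)"
      by (intro divide_right_mono R_le) auto
    also have "\<dots> = C / (1 - \<alpha>) * ((1 - \<alpha>) * (real n + 1) powr (- (1 - \<alpha>) - 1))"
      using a by (simp add: powr_diff power2_eq_square add.commute)
    also have "\<dots> \<le> C / (1 - \<alpha>) * (real n powr (- (1 - \<alpha>)) - (real n + 1) powr (- (1 - \<alpha>)))"
      using C a n by (intro mult_left_mono powr_neg_diff_ge) auto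
    also have "\<dots> = g n - g (Suc n)" by (simp add: g_def algebra_simps)
    finally show ?thesis .
  qed
  obtain l where l: "A \<longlonglongrightarrow> l" "\<And>n. n \<ge> 1 \<Longrightarrow> norm (l - A n) \<le> g n"
    using telescoping_majorant_tendsto[OF g0 step] by blast
  have "(\<lambda>N. exp_series_partial f N t) \<longlonglongrightarrow> l"
    using tendsto_add[OF l(1) R0] by (simp add: A_def)
  \<comment> \<open>Convergence has just been established, so the \<open>lim\<close> in
    \<open>exp_series\<close> is a genuine limit.\<close>
  then have F: "exp_series f t = l"
    unfolding exp_series_def exp_series_partial_def by (rule limI)
  have "norm (exp_series f t - exp_series_partial f N t) \<le> norm (l - A N) + norm (R N)"
    using norm_triangle_ineq4[of "l - A N" "R N"] by (simp add: F A_def)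
  also have "\<dots> \<le> g N + C * real N powr (\<alpha> - 1)" using l(2) R_le assms by (intro add_mono)
  finally show ?thesis by (simp add: g_def distrib_right)
qed

lemma exp_series_Holder:
  obtains L where "L > 0" "\<And>s t. s \<in> {0..1} \<Longrightarrow> t \<in> {0..1} \<Longrightarrow>
    norm (exp_series f s - exp_series f t) \<le> L * \<bar>s - t\<bar> powr (1 - \<alpha>)"
proof
  define D where "D = C / (1 - \<alpha>) + C"
  have D: "D > 0" using C a by (simp add: D_def add_pos_pos)
  \<comment> \<open>The tails at \<open>s\<close> and at \<open>t\<close> cost \<open>2 * D\<close>
    each, the Lipschitz bound for the partial sum costs \<open>2 * pi * C\<close>.\<close>
  show "4 * D + 2 * pi * C > 0" using C D by (simp add: add_pos_pos)
  fix s t :: real assume st: "s \<in> {0..1}" "t \<in> {0..1}"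
  show "norm (exp_series f s - exp_series f t) \<le> (4 * D + 2 * pi * C) * \<bar>s - t\<bar> powr (1 - \<alpha>)"
  proof (cases "s = t")
    case True
    then show ?thesis by simp
  next
    case False
    define h where "h = \<bar>s - t\<bar>"
    have h: "0 < h" "h \<le> 1" using False st by (auto simp: h_def)
    \<comment> \<open>This size balances the tail \<open>N powr (\<alpha> - 1)\<close> against the
      Lipschitz term \<open>N powr \<alpha> * h\<close>. Since \<open>h \<le> 1\<close> on the unit
      interval, \<open>N \<ge> 1\<close>.\<close>
    define N where "N = nat \<lfloor>1 / h\<rfloor>"
    have "1 / h \<ge> 1" using h by simp
    then have N: "N \<ge> 1" "real N \<le> 1 / h" "1 / h \<le> real N + 1"
      unfolding N_def by linarith+
    \<comment> \<open>Rounding down loses at most a factor 2, which becomes the 2 in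
      \<open>Nh\<close>.\<close>
    have "1 / h \<le> 2 * real N" using N by linarith
    then have "inverse (real N) \<le> 2 * h" using h N by (simp add: field_simps)
    then have "inverse (real N) powr (1 - \<alpha>) \<le> (2 * h) powr (1 - \<alpha>)"
      using a by (intro powr_mono2) auto
    also have "\<dots> = 2 powr (1 - \<alpha>) * h powr (1 - \<alpha>)" using h by (simp add: powr_mult)
    also have "\<dots> \<le> 2 powr 1 * h powr (1 - \<alpha>)"
      using a by (intro mult_right_mono powr_mono) auto
    finally have Nh: "real N powr (\<alpha> - 1) \<le> 2 * h powr (1 - \<alpha>)"
      using N powr_minus[of "real N" "1 - \<alpha>"] by (simp add: inverse_powr)
    have tail: "norm (exp_series f u - exp_series_partial f N u) \<le> 2 * D * h powr (1 - \<alpha>)" for u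
    proof -
      have "norm (exp_series f u - exp_series_partial f N u) \<le> D * real N powr (\<alpha> - 1)"
        using exp_series_tail_le[OF N(1)] by (simp add: D_def)
      also have "\<dots> \<le> D * (2 * h powr (1 - \<alpha>))" using Nh D by (intro mult_left_mono) auto
      finally show ?thesis by simp
    qed
    have "norm (exp_series_partial f N s - exp_series_partial f N t)
        \<le> 2 * pi * C * real N powr \<alpha> * h"
      using exp_series_partial_Lipschitz[OF N(1)] by (simp add: h_def)
    also have "\<dots> \<le> 2 * pi * C * (1 / h) powr \<alpha> * h"
      using N C a h by (intro mult_right_mono mult_left_mono powr_mono2) auto
    also have "\<dots> = 2 * pi * C * h powr (1 - \<alpha>)"
      using h by (simp add: powr_diff powr_divide)
    finally have "norm (exp_series_partial f N s - exp_series_partial f N t)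
        \<le> 2 * pi * C * h powr (1 - \<alpha>)" .
    moreover have "norm (exp_series f s - exp_series f t)
        \<le> norm (exp_series f s - exp_series_partial f N s)
          + norm (exp_series_partial f N s - exp_series_partial f N t)
          + norm (exp_series f t - exp_series_partial f N t)"
      by norm
    ultimately show ?thesis
      using tail[of s] tail[of t] unfolding h_def[symmetric] by (simp add: algebra_simps)
  qed
qed

end

theorem corollary1p2:
  fixes f :: "nat \<Rightarrow> complex" and C \<alpha> :: real
  assumes "C > 0" and "0 < \<alpha>" and "\<alpha> < 1"
    and "\<And>x t :: real. x \<ge> 1 \<Longrightarrow> norm (exp_sum f x t) \<le> C * x powr \<alpha>"
  shows "upper_box_dim ((\<lambda>t. (Re (exp_series f t), Im (exp_series f t))) ` {0..1::real})
           \<le> ereal (1 / (1 - \<alpha>))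
    \<and> upper_box_dim ((\<lambda>t. (t, norm (exp_series f t))) ` {0..1::real}) \<le> ereal (1 + \<alpha>)
    \<and> upper_box_dim ((\<lambda>t. (t, Re (exp_series f t))) ` {0..1::real}) \<le> ereal (1 + \<alpha>)
    \<and> upper_box_dim ((\<lambda>t. (t, Im (exp_series f t))) ` {0..1::real}) \<le> ereal (1 + \<alpha>)"
proof -
  obtain L where L: "L > 0" and hol: "\<And>s t. s \<in> {0..1} \<Longrightarrow> t \<in> {0..1} \<Longrightarrow>
      norm (exp_series f s - exp_series f t) \<le> L * \<bar>s - t\<bar> powr (1 - \<alpha>)"
    using exp_series_Holder[OF assms] by blast
  have b: "1 - \<alpha> > 0" "1 - \<alpha> \<le> 1" using assms by auto
  \<comment> \<open>The modulus, \<open>Re\<close> and \<open>Im\<close> are all 1-Lipschitz, so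
    composing with them preserves the Hoelder bound, and
    \<open>2 - (1 - \<alpha>) = 1 + \<alpha>\<close>.\<close>
  have graph: "upper_box_dim ((\<lambda>t. (t, p (exp_series f t))) ` {0..1::real}) \<le> ereal (1 + \<alpha>)"
    if p: "\<And>z w. \<bar>p z - p w\<bar> \<le> norm (z - w)" for p :: "complex \<Rightarrow> real"
  proof -
    have "upper_box_dim ((\<lambda>t. (t, p (exp_series f t))) ` {0..1}) \<le> ereal (2 - (1 - \<alpha>))"
      using order_trans[OF p hol] by (intro upper_box_dim_Holder_graph[OF L b])
    then show ?thesis by simp
  qed
  show ?thesis
  proof (intro conjI graph)
    show "upper_box_dim ((\<lambda>t. (Re (exp_series f t), Im (exp_series f t))) ` {0..1::real})
        \<le> ereal (1 / (1 - \<alpha>))"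
      \<comment> \<open>Identifying a complex number with its pair of coordinates is an
        isometry.\<close>
      by (rule upper_box_dim_Holder_image[OF L b(1)])
         (use hol in \<open>simp add: norm_prod_def cmod_def\<close>)
    show "\<bar>Re z - Re w\<bar> \<le> norm (z - w)" "\<bar>Im z - Im w\<bar> \<le> norm (z - w)"
      "\<bar>norm z - norm w\<bar> \<le> norm (z - w)" for z w :: complex
      using abs_Re_le_cmod[of "z - w"] abs_Im_le_cmod[of "z - w"] norm_triangle_ineq3[of z w]
      by auto
  qed
qed

end
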